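(* Let $X$ be a normed space, let $\{x_t\}_{t\in\mathbb{N}}$ be a sequence in $X$, let $\{\omega_t\}_{t\in\mathbb{N}}$ be a weighted sequence, let $r\ge 0$, and let $\mathcal{I}$ be an analytic $P$-ideal on $\mathbb{N}$. Then the rough weighted $\mathcal{I}$-limit set $(\omega_t,\mathcal{I})\text{-}\mathrm{LIM}^r x_t$ is an $F_{\sigma\delta}$ subset of $X$ (hence a Borel subset of $X$).
   Context: A sequence $\{\omega_t\}_{t\in\mathbb{N}}$ of real numbers is a weighted sequence if there is $\beta>0$ with $\omega_t>\beta$ for all $t\in\mathbb{N}$. An ideal on $\mathbb{N}$ is a family $\mathcal{I}\subseteq\mathcal{P}(\mathbb{N})$ with $\varnothing\in\mathcal{I}$, closed under finite unions and under taking subsets. A submeasure on $\mathbb{N}$ is a map $\varphi:\mathcal{P}(\mathbb{N})\to[0,\infty]$ with $\varphi(\varnothing)=0$; $\varphi(A)\le\varphi(B)$ whenever $A\subseteq B$; $\varphi(A\cup B)\le\varphi(A)+\varphi(B)$; and $\varphi(\{t\})<\infty$ for all $t\in\mathbb{N}$. It is lower semicontinuous if $\varphi(A)=\lim_{t\to\infty}\varphi(A\cap[1,t])$ for all $A\subseteq\mathbb{N}$. A $P$-ideal is an ideal $\mathcal{I}$ such that for every sequence $\{A_t\}_{t\in\mathbb{N}}$ in $\mathcal{I}$ there is $A\in\mathcal{I}$ with $A_t\setminus A$ finite for each $t$. A $P$-ideal $\mathcal{I}$ is analytic if there is a lower semicontinuous submeasure $\varphi$ on $\mathbb{N}$ with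 $\mathcal{I}=\mathcal{I}_\varphi:=\{A\subseteq\mathbb{N}:\lim_{t\to\infty}\varphi(A\setminus\{1,2,\dots,t\})=0\}$. For $r\ge0$, $(\omega_t,\mathcal{I})\text{-}\mathrm{LIM}^r x_t$ is the set of all $x_*\in X$ such that $\{t\in\mathbb{N}:\omega_t\|x_t-x_*\|>r+\varepsilon\}\in\mathcal{I}$ for every $\varepsilon>0$. An $F_{\sigma\delta}$ set is a countable intersection of countable unions of closed sets. *)

theory Defs
  imports "HOL-Analysis.Analysis"
begin

text \<open>
  Sequences and subsets indexed by the positive integers are indexed by \<^typ>\<open>nat\<close>, starting
  at 0. The first \<open>t\<close> indices, written \<open>[1,t]\<close> in the usual notation, therefore are
  \<^term>\<open>{..<t::nat}\<close>.
\<close>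

definition weighted_sequence :: "(nat \<Rightarrow> real) \<Rightarrow> bool" where
  "weighted_sequence \<omega> \<longleftrightarrow> (\<exists>\<beta>>0. \<forall>t. \<omega> t > \<beta>)"

text \<open>Properness and containment of the finite sets are not required.\<close>

definition set_ideal :: "nat set set \<Rightarrow> bool" where
  "set_ideal I \<longleftrightarrow>
     {} \<in> I \<and> (\<forall>A\<in>I. \<forall>B\<in>I. A \<union> B \<in> I) \<and> (\<forall>A\<in>I. \<forall>B. B \<subseteq> A \<longrightarrow> B \<in> I)"

definition P_ideal :: "nat set set \<Rightarrow> bool" where
  "P_ideal I \<longleftrightarrow> set_ideal I \<and>
     (\<forall>A :: nat \<Rightarrow> nat set. (\<forall>t. A t \<in> I) \<longrightarrow> (\<exists>B\<in>I. \<forall>t. finite (A t - B)))"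

definition submeasure :: "(nat set \<Rightarrow> ennreal) \<Rightarrow> bool" where
  "submeasure \<phi> \<longleftrightarrow>
     \<phi> {} = 0 \<and> (\<forall>A B. A \<subseteq> B \<longrightarrow> \<phi> A \<le> \<phi> B) \<and>
     (\<forall>A B. \<phi> (A \<union> B) \<le> \<phi> A + \<phi> B) \<and> (\<forall>t. \<phi> {t} < \<infinity>)"

definition lsc_submeasure :: "(nat set \<Rightarrow> ennreal) \<Rightarrow> bool" where
  "lsc_submeasure \<phi> \<longleftrightarrow>
     submeasure \<phi> \<and> (\<forall>A. (\<lambda>t. \<phi> (A \<inter> {..<t})) \<longlonglongrightarrow> \<phi> A)"

definition submeasure_ideal :: "(nat set \<Rightarrow> ennreal) \<Rightarrow> nat set set" where
  "submeasure_ideal \<phi> = {A. (\<lambda>t. \<phi> (A - {..<t})) \<longlonglongrightarrow> 0}"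

definition analytic_P_ideal :: "nat set set \<Rightarrow> bool" where
  "analytic_P_ideal I \<longleftrightarrow> P_ideal I \<and> (\<exists>\<phi>. lsc_submeasure \<phi> \<and> I = submeasure_ideal \<phi>)"

definition rough_weighted_LIM ::
    "(nat \<Rightarrow> real) \<Rightarrow> nat set set \<Rightarrow> real \<Rightarrow> (nat \<Rightarrow> 'a::real_normed_vector) \<Rightarrow> 'a set" where
  "rough_weighted_LIM \<omega> I r x = {x'. \<forall>\<epsilon>>0. {t. \<omega> t * norm (x t - x') > r + \<epsilon>} \<in> I}"

definition fsigma_delta :: "'a::topological_space set \<Rightarrow> bool" where
  "fsigma_delta S \<longleftrightarrow> (\<exists>F :: nat \<Rightarrow> 'a set. (\<forall>n. fsigma (F n)) \<and> S = (\<Inter>n. F n))"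

end

theory Submission
  imports Defs
begin

text \<open>
  By the exhaustive description \<open>submeasure_ideal \<phi>\<close> of the ideal, a set \<open>A\<close> belongs to it iff for
  every \<open>m\<close> some tail \<open>A - {..<t}\<close> has \<open>\<phi>\<close>-mass at most \<open>1 / (m + 1)\<close>: one universal quantifier over
  a countable set followed by an existential one. The limit set asks this of the sets
  \<open>{t. \<omega> t * norm (x t - y) > r + \<epsilon>}\<close>, and letting \<open>\<epsilon>\<close> run through \<open>1 / (k + 1)\<close> suffices because
  these sets grow as \<open>\<epsilon>\<close> decreases and ideals are closed under subsets. So everything rests on the
  conditions that bound the mass of a tail being closed in \<open>y\<close>.

  They are closed because two kinds of semicontinuity meet. The inequality defining the sets is
  strict, so each index that belongs to the set of \<open>y\<close> belongs to the sets of all points near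
  \<open>y\<close>; the same then holds for finitely many indices at once. Lower semicontinuity of \<open>\<phi>\<close> says that
  a set of mass above \<open>c\<close> has a finite subset of mass above \<open>c\<close>. Hence the mass stays
  above \<open>c\<close> near \<open>y\<close> (lemma \<open>closed_submeasure_le\<close>).
\<close>

lemma submeasure_mono:
  "submeasure \<phi> \<Longrightarrow> A \<subseteq> B \<Longrightarrow> \<phi> A \<le> \<phi> B"
  by (auto simp: submeasure_def)

lemma lsc_submeasure_imp_submeasure: "lsc_submeasure \<phi> \<Longrightarrow> submeasure \<phi>"
  by (simp add: lsc_submeasure_def)

lemma lsc_submeasure_finite_subset:
  assumes "lsc_submeasure \<phi>" and "c < \<phi> A"
  obtains F where "finite F" "F \<subseteq> A" "c < \<phi> F"
proof -
  have "(\<lambda>t. \<phi> (A \<inter> {..<t})) \<longlonglongrightarrow> \<phi> A"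
    using assms(1) by (simp add: lsc_submeasure_def)
  then have "eventually (\<lambda>t. c < \<phi> (A \<inter> {..<t})) sequentially"
    using assms(2) by (rule order_tendstoD)
  then obtain t where "c < \<phi> (A \<inter> {..<t})"
    by (auto simp: eventually_sequentially)
  then show thesis
    by (intro that[of "A \<inter> {..<t}"]) auto
qed

text \<open>
  The complement is open: a point where the mass exceeds \<open>c\<close> has a finite set \<open>F\<close> of indices
  witnessing this, and \<open>F\<close> remains a witness on the finite intersection of the \<open>U s\<close> with \<open>s \<in> F\<close>.
\<close>

lemma closed_submeasure_le:
  fixes U :: "nat \<Rightarrow> 'a::topological_space set"
  assumes lsc: "lsc_submeasure \<phi>" and "\<And>s. open (U s)"
  shows "closed {y. \<phi> ({s. y \<in> U s} - T) \<le> c}"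
proof -
  let ?W = "\<lambda>F. \<Inter>s\<in>F. U s"
  let ?\<F> = "{F. finite F \<and> F \<inter> T = {} \<and> c < \<phi> F}"
  have "- {y. \<phi> ({s. y \<in> U s} - T) \<le> c} = (\<Union>F\<in>?\<F>. ?W F)"
  proof (intro equalityI subsetI)
    fix y assume "y \<in> - {y. \<phi> ({s. y \<in> U s} - T) \<le> c}"
    then have "c < \<phi> ({s. y \<in> U s} - T)"
      by (simp add: not_le)
    then obtain F where "finite F" "F \<subseteq> {s. y \<in> U s} - T" "c < \<phi> F"
      by (rule lsc_submeasure_finite_subset[OF lsc])
    then show "y \<in> (\<Union>F\<in>?\<F>. ?W F)"
      by blast
  next
    fix y assume "y \<in> (\<Union>F\<in>?\<F>. ?W F)"
    then obtain F where F: "F \<inter> T = {}" "c < \<phi> F" "y \<in> ?W F"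
      by blast
    then have "F \<subseteq> {s. y \<in> U s} - T"
      by blast
    then have "\<phi> F \<le> \<phi> ({s. y \<in> U s} - T)"
      by (rule submeasure_mono[OF lsc_submeasure_imp_submeasure[OF lsc]])
    then show "y \<in> - {y. \<phi> ({s. y \<in> U s} - T) \<le> c}"
      using F(2) by (simp add: not_le)
  qed
  moreover have "open (\<Union>F\<in>?\<F>. ?W F)"
    using assms(2) by (intro open_UN ballI open_INT) auto
  ultimately show ?thesis
    by (simp add: closed_def)
qed

text \<open>
  The tails decrease, so convergence of their masses to 0 needs only one small tail for each
  bound; this removes the innermost universal quantifier of the limit.
\<close>

lemma mem_submeasure_ideal_iff:
  assumes "submeasure \<phi>"
  shows "A \<in> submeasure_ideal \<phi> \<longleftrightarrow>
    (\<forall>m. \<exists>t. \<phi> (A - {..<t}) \<le> ennreal (1 / real (Suc m)))"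
proof
  assume "A \<in> submeasure_ideal \<phi>"
  then have lim: "(\<lambda>t. \<phi> (A - {..<t})) \<longlonglongrightarrow> 0"
    by (simp add: submeasure_ideal_def)
  show "\<forall>m. \<exists>t. \<phi> (A - {..<t}) \<le> ennreal (1 / real (Suc m))"
  proof
    fix m
    have "0 < ennreal (1 / real (Suc m))"
      by (subst ennreal_less_zero_iff) simp
    then have "eventually (\<lambda>t. \<phi> (A - {..<t}) < ennreal (1 / real (Suc m))) sequentially"
      by (rule order_tendstoD(2)[OF lim])
    then show "\<exists>t. \<phi> (A - {..<t}) \<le> ennreal (1 / real (Suc m))"
      by (meson eventually_sequentially less_imp_le order_refl)
  qed
next
  assume small: "\<forall>m. \<exists>t. \<phi> (A - {..<t}) \<le> ennreal (1 / real (Suc m))"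
  have "(\<lambda>t. \<phi> (A - {..<t})) \<longlonglongrightarrow> 0"
  proof (rule order_tendstoI)
    fix a :: ennreal assume "0 < a"
    then obtain b where b: "0 < b" "b < a"
      using dense by blast
    then obtain e where e: "b = ennreal e" "0 < e"
      by (cases b) auto
    then obtain m where "1 / real (Suc m) < e"
      using nat_approx_posE by blast
    then have m: "ennreal (1 / real (Suc m)) < a"
      using e b(2) by (metis ennreal_leI le_less_trans less_imp_le)
    obtain t where t: "\<phi> (A - {..<t}) \<le> ennreal (1 / real (Suc m))"
      using small by blast
    have "\<phi> (A - {..<u}) < a" if "t \<le> u" for u
    proof -
      have "\<phi> (A - {..<u}) \<le> \<phi> (A - {..<t})"
        using that by (intro submeasure_mono[OF assms]) auto
      then show ?thesis
        using t m by (meson le_less_trans)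
    qed
    then show "eventually (\<lambda>t. \<phi> (A - {..<t}) < a) sequentially"
      by (auto simp: eventually_sequentially)
  qed simp
  then show "A \<in> submeasure_ideal \<phi>"
    by (simp add: submeasure_ideal_def)
qed

lemma fsigma_delta_INT:
  fixes S :: "nat \<Rightarrow> 'a::topological_space set"
  assumes "\<And>k. fsigma_delta (S k)"
  shows "fsigma_delta (\<Inter>k. S k)"
proof -
  have "\<forall>k. \<exists>F :: nat \<Rightarrow> 'a set. (\<forall>n. fsigma (F n)) \<and> S k = (\<Inter>n. F n)"
    using assms by (simp add: fsigma_delta_def)
  then obtain F :: "nat \<Rightarrow> nat \<Rightarrow> 'a set"
    where "\<forall>k. (\<forall>n. fsigma (F k n)) \<and> S k = (\<Inter>n. F k n)"
    by (rule choice[THEN exE])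
  then have F: "\<And>k n. fsigma (F k n)" "\<And>k. S k = (\<Inter>n. F k n)"
    by auto
  let ?G = "\<lambda>n. F (fst (prod_decode n)) (snd (prod_decode n))"
  have "(\<Inter>k. S k) = (\<Inter>p\<in>range prod_decode. F (fst p) (snd p))"
    unfolding F(2) surj_prod_decode by auto
  also have "\<dots> = (\<Inter>n. ?G n)"
    by (simp only: image_image)
  finally show ?thesis
    unfolding fsigma_delta_def using F(1) by (intro exI[of _ ?G]) simp
qed

lemma fsigma_delta_imp_borel:
  fixes S :: "'a::topological_space set"
  assumes "fsigma_delta S"
  shows "S \<in> sets borel"
proof -
  obtain F :: "nat \<Rightarrow> 'a set" where F: "\<And>n. fsigma (F n)" "S = (\<Inter>n. F n)"
    using assms unfolding fsigma_delta_def by blast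
  have "F n \<in> sets borel" for n
    using F(1)[of n] by cases auto
  then show ?thesis
    unfolding F(2) by (intro sets.countable_INT'') auto
qed

lemma fsigma_delta_submeasure_ideal:
  fixes U :: "nat \<Rightarrow> 'a::topological_space set"
  assumes "lsc_submeasure \<phi>" and "\<And>s. open (U s)"
  shows "fsigma_delta {y. {s. y \<in> U s} \<in> submeasure_ideal \<phi>}"
proof -
  let ?C = "\<lambda>m t. {y. \<phi> ({s. y \<in> U s} - {..<t}) \<le> ennreal (1 / real (Suc m))}"
  have "fsigma (\<Union>t. ?C m t)" for m
    by (rule fsigma.intros) (rule closed_submeasure_le[OF assms])
  moreover have "{y. {s. y \<in> U s} \<in> submeasure_ideal \<phi>} = (\<Inter>m. \<Union>t. ?C m t)"
    by (simp add: set_eq_iff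
        mem_submeasure_ideal_iff[OF lsc_submeasure_imp_submeasure[OF assms(1)]]
        del: of_nat_Suc)
  ultimately show ?thesis
    unfolding fsigma_delta_def by (intro exI[of _ "\<lambda>m. \<Union>t. ?C m t"]) auto
qed

text \<open>
  The exceptional sets increase as \<open>\<epsilon>\<close> decreases, so a sequence of \<open>\<epsilon>\<close> tending to 0 decides
  membership.
\<close>

lemma rough_weighted_LIM_countable:
  assumes "set_ideal I"
  shows "rough_weighted_LIM \<omega> I r x =
    (\<Inter>k. {y. {t. \<omega> t * norm (x t - y) > r + 1 / real (Suc k)} \<in> I})"
proof (intro equalityI subsetI)
  fix y assume "y \<in> rough_weighted_LIM \<omega> I r x"
  then show "y \<in> (\<Inter>k. {y. {t. \<omega> t * norm (x t - y) > r + 1 / real (Suc k)} \<in> I})"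
    by (simp add: rough_weighted_LIM_def del: of_nat_Suc)
next
  fix y assume y: "y \<in> (\<Inter>k. {y. {t. \<omega> t * norm (x t - y) > r + 1 / real (Suc k)} \<in> I})"
  have "{t. \<omega> t * norm (x t - y) > r + \<epsilon>} \<in> I" if "\<epsilon> > 0" for \<epsilon>
  proof -
    obtain k where "1 / real (Suc k) < \<epsilon>"
      using nat_approx_posE[OF \<open>\<epsilon> > 0\<close>] by blast
    then have "{t. \<omega> t * norm (x t - y) > r + \<epsilon>}
        \<subseteq> {t. \<omega> t * norm (x t - y) > r + 1 / real (Suc k)}"
      by auto
    moreover have "{t. \<omega> t * norm (x t - y) > r + 1 / real (Suc k)} \<in> I"
      using y by blast
    ultimately show ?thesis
      using assms unfolding set_ideal_def by blast
  qed
  then show "y \<in> rough_weighted_LIM \<omega> I r x"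
    by (simp add: rough_weighted_LIM_def)
qed

theorem proposition2p1:
  fixes x :: "nat \<Rightarrow> 'a::real_normed_vector"
    and \<omega> :: "nat \<Rightarrow> real"
    and r :: real
    and I :: "nat set set"
  assumes "weighted_sequence \<omega>"
    and "r \<ge> 0"
    and "analytic_P_ideal I"
  shows "fsigma_delta (rough_weighted_LIM \<omega> I r x) \<and> rough_weighted_LIM \<omega> I r x \<in> sets borel"
proof -
  obtain \<phi> where \<phi>: "lsc_submeasure \<phi>" "I = submeasure_ideal \<phi>" and "set_ideal I"
    using assms(3) unfolding analytic_P_ideal_def P_ideal_def by blast
  have "fsigma_delta {y. {t. \<omega> t * norm (x t - y) > r + \<epsilon>} \<in> I}" for \<epsilon>
  proof -
    have "open {y. \<omega> t * norm (x t - y) > r + \<epsilon>}" for t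
      by (intro open_Collect_less continuous_intros)
    from fsigma_delta_submeasure_ideal[OF \<phi>(1) this]
    show ?thesis
      by (simp add: \<phi>(2))
  qed
  then have "fsigma_delta (rough_weighted_LIM \<omega> I r x)"
    unfolding rough_weighted_LIM_countable[OF \<open>set_ideal I\<close>] by (rule fsigma_delta_INT)
  then show ?thesis
    using fsigma_delta_imp_borel by blast
qed

end
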